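(* Let $\mu>\mu_{\min}$, where $\mu_{\min}=2+\omega+\omega^{-1}\approx4.38$ with $\omega=\frac13\left(\sqrt[3]{19+3\sqrt{33}}+\sqrt[3]{19-3\sqrt{33}}+1\right)$, and put $\theta=\frac{-(\mu-2)-\sqrt{(\mu-2)^2-4}}{2}$, $\psi(t)=2-\mu-\frac1t$ for $t\neq0$. Let $(T_1,T_2,\dots)$ be any sequence of starlike trees chosen successively such that $$S_1:=1-\mu+\delta(T_1,\mu)<\theta^{-1},\qquad S_j:=\psi(S_{j-1})+\delta(T_j,\mu)<\theta^{-1}\quad (j\ge2),$$ and let $G_k=[T_1,\dots,T_k]$ for $k\ge1$. Then $\rho_L(G_k)<\mu$ and $\rho_L(G_k)<\rho_L(G_{k+1})$ for all $k$, and consequently $\lim_{k\to\infty}\rho_L(G_k)$ exists and is at most $\mu$.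
   Context: For a finite graph $G$, $\rho_L(G)$ is the largest eigenvalue of the Laplacian matrix $L(G)=D(G)-A(G)$. Starlike trees and linear trees: a starlike tree is encoded as $T=[q_1,\dots,q_r]$ with positive integers $q_1\le\dots\le q_r$, or $T=[0]$ (empty). The linear tree $[T_1,\dots,T_k]$ is the tree obtained from a path $v_1v_2\cdots v_k$ (main path) by attaching at each $v_j$, for $T_j=[q_1,\dots,q_r]$, $r$ disjoint pendant paths with $q_1,\dots,q_r$ vertices respectively (an end vertex of each path is joined to $v_j$ by an edge); if $T_j=[0]$ nothing is attached at $v_j$. Drift: for real $\mu$ put $b_1=1-\mu$ and $b_{i+1}=2-\mu-\frac1{b_i}$. Then $\delta([q_1,\dots,q_r],\mu)=\sum_{i=1}^r\left(1-\frac1{b_{q_i}}\right)$ and $\delta([0],\mu)=0$. *)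

theory Defs
  imports "HOL-Analysis.Analysis" "Jordan_Normal_Form.Spectral_Radius"
begin

type_synonym 'a graph = "'a set \<times> 'a set set"

definition finite_simple_graph :: "'a graph \<Rightarrow> bool" where
  "finite_simple_graph G \<longleftrightarrow>
     finite (fst G) \<and> (\<forall>e\<in>snd G. e \<subseteq> fst G \<and> card e = 2)"

definition vertex_degree :: "'a graph \<Rightarrow> 'a \<Rightarrow> nat" where
  "vertex_degree G v = card {e \<in> snd G. v \<in> e}"

definition degree_matrix :: "'a graph \<Rightarrow> 'a list \<Rightarrow> real mat" where
  "degree_matrix G vs =
     mat (length vs) (length vs) (\<lambda>(i, j). if i = j then real (vertex_degree G (vs ! i)) else 0)"

definition adjacency_matrix :: "'a graph \<Rightarrow> 'a list \<Rightarrow> real mat" where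
  "adjacency_matrix G vs =
     mat (length vs) (length vs) (\<lambda>(i, j). if {vs ! i, vs ! j} \<in> snd G then 1 else 0)"

definition laplacian_matrix :: "'a graph \<Rightarrow> 'a list \<Rightarrow> real mat" where
  "laplacian_matrix G vs = degree_matrix G vs - adjacency_matrix G vs"

definition vertex_enum :: "'a graph \<Rightarrow> 'a list" where
  "vertex_enum G = (SOME vs. distinct vs \<and> set vs = fst G)"

text \<open>The order in which the vertices are listed does not affect the spectrum: see
  \<open>spectrum_laplacian_matrix_enum\<close> below.\<close>

definition rho_L :: "'a graph \<Rightarrow> real" where
  "rho_L G = Max (spectrum (laplacian_matrix G (vertex_enum G)))"

text \<open>Starlike trees and the linear tree \<open>[T\<^sub>1, \<dots>, T\<^sub>k]\<close>, the starlike trees being encoded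
  as lists of numbers. In \<open>linear_tree\<close> everything is indexed from 0: \<open>Main j\<close> is the main-path
  vertex carrying \<open>Ts ! j\<close>, and \<open>Pend j i m\<close>, for \<open>m < Ts ! j ! i\<close>, are the vertices of the
  \<open>i\<close>-th pendant path at \<open>Main j\<close>, joined to \<open>Main j\<close> by its end vertex \<open>Pend j i 0\<close>.
  The list \<open>[0]\<close> contributes no pendant vertex and no edge.\<close>

definition starlike_tree :: "nat list \<Rightarrow> bool" where
  "starlike_tree T \<longleftrightarrow> T = [0] \<or> (T \<noteq> [] \<and> sorted T \<and> (\<forall>q\<in>set T. 0 < q))"

datatype lt_vertex = Main nat | Pend nat nat nat

definition linear_tree :: "nat list list \<Rightarrow> lt_vertex graph" where
  "linear_tree Ts =
    ({Main j | j. j < length Ts} \<union>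
     {Pend j i m | j i m. j < length Ts \<and> i < length (Ts ! j) \<and> m < Ts ! j ! i},
     {{Main j, Main (Suc j)} | j. Suc j < length Ts} \<union>
     {{Main j, Pend j i 0} | j i. j < length Ts \<and> i < length (Ts ! j) \<and> 0 < Ts ! j ! i} \<union>
     {{Pend j i m, Pend j i (Suc m)} | j i m.
        j < length Ts \<and> i < length (Ts ! j) \<and> Suc m < Ts ! j ! i})"

text \<open>The sequence \<open>b\<^sub>1, b\<^sub>2, \<dots>\<close> starts at index 1; its value at 0 is a dummy.\<close>

fun b_seq :: "real \<Rightarrow> nat \<Rightarrow> real" where
  "b_seq \<mu> 0 = 0"
| "b_seq \<mu> (Suc 0) = 1 - \<mu>"
| "b_seq \<mu> (Suc (Suc i)) = 2 - \<mu> - 1 / b_seq \<mu> (Suc i)"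

definition drift :: "nat list \<Rightarrow> real \<Rightarrow> real" where
  "drift T \<mu> = (if T = [0] then 0 else (\<Sum>q\<leftarrow>T. 1 - 1 / b_seq \<mu> q))"

definition \<omega> :: real where
  "\<omega> = (root 3 (19 + 3 * sqrt 33) + root 3 (19 - 3 * sqrt 33) + 1) / 3"

definition \<mu>_min :: real where
  "\<mu>_min = 2 + \<omega> + inverse \<omega>"

definition \<theta> :: "real \<Rightarrow> real" where
  "\<theta> \<mu> = (- (\<mu> - 2) - sqrt ((\<mu> - 2)\<^sup>2 - 4)) / 2"

text \<open>Only used for \<open>t \<noteq> 0\<close>: for \<open>\<mu> > \<mu>_min\<close> the bound \<open>inverse (\<theta> \<mu>)\<close> imposed on the
  arguments is negative.\<close>

definition \<psi> :: "real \<Rightarrow> real \<Rightarrow> real" where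
  "\<psi> \<mu> t = 2 - \<mu> - 1 / t"

lemma finite_simple_graph_linear_tree: "finite_simple_graph (linear_tree Ts)"
proof -
  have "{Pend j i m | j i m. j < length Ts \<and> i < length (Ts ! j) \<and> m < Ts ! j ! i} =
      (\<Union>j<length Ts. \<Union>i<length (Ts ! j). Pend j i ` {..<Ts ! j ! i})"
    by auto
  then have "finite {Pend j i m | j i m. j < length Ts \<and> i < length (Ts ! j) \<and> m < Ts ! j ! i}"
    by simp
  then show ?thesis
    unfolding finite_simple_graph_def linear_tree_def by (auto simp: card_insert_if)
qed

lemma eigenvalue_laplacian_matrix_iff:
  assumes "distinct vs"
  shows "eigenvalue (laplacian_matrix G vs) k \<longleftrightarrow>
    (\<exists>f. (\<exists>v\<in>set vs. f v \<noteq> 0) \<and>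
      (\<forall>v\<in>set vs. real (vertex_degree G v) * f v - (\<Sum>w\<in>set vs. if {v, w} \<in> snd G then f w else 0) = k * f v))"
    (is "_ \<longleftrightarrow> (\<exists>f. ?P f)")
proof -
  let ?n = "length vs" and ?L = "laplacian_matrix G vs"
  have dim: "dim_row ?L = ?n" "dim_col ?L = ?n"
    by (simp_all add: laplacian_matrix_def degree_matrix_def adjacency_matrix_def)
  have L: "?L $$ (i, j) = (if i = j then real (vertex_degree G (vs ! i)) else 0)
      - (if {vs ! i, vs ! j} \<in> snd G then 1 else 0)" if "i < ?n" "j < ?n" for i j
    using that by (simp add: laplacian_matrix_def degree_matrix_def adjacency_matrix_def)
  have row: "(?L *\<^sub>v vec ?n (\<lambda>i. f (vs ! i))) $ i =
      real (vertex_degree G (vs ! i)) * f (vs ! i) -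
      (\<Sum>w\<in>set vs. if {vs ! i, w} \<in> snd G then f w else 0)" if i: "i < ?n" for i f
  proof -
    have "(?L *\<^sub>v vec ?n (\<lambda>i. f (vs ! i))) $ i = (\<Sum>j<?n. ?L $$ (i, j) * f (vs ! j))"
      using i dim by (simp add: scalar_prod_def atLeast0LessThan)
    also have "\<dots> = (\<Sum>j<?n. (if i = j then real (vertex_degree G (vs ! i)) * f (vs ! j) else 0)
        - (if {vs ! i, vs ! j} \<in> snd G then f (vs ! j) else 0))"
      by (rule sum.cong) (auto simp: L i algebra_simps)
    also have "\<dots> = real (vertex_degree G (vs ! i)) * f (vs ! i)
        - (\<Sum>j<?n. if {vs ! i, vs ! j} \<in> snd G then f (vs ! j) else 0)"
      using i by (simp add: sum_subtractf)
    also have "(\<Sum>j<?n. if {vs ! i, vs ! j} \<in> snd G then f (vs ! j) else 0) =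
        (\<Sum>w\<in>set vs. if {vs ! i, w} \<in> snd G then f w else 0)"
      by (rule sum.reindex_bij_betw[OF bij_betw_nth[OF assms refl refl]])
    finally show ?thesis .
  qed
  have eq: "eigenvector ?L (vec ?n (\<lambda>i. f (vs ! i))) k \<longleftrightarrow> ?P f" for f
  proof -
    have "eigenvector ?L (vec ?n (\<lambda>i. f (vs ! i))) k \<longleftrightarrow>
        (\<exists>i<?n. f (vs ! i) \<noteq> 0) \<and>
        (\<forall>i<?n. (?L *\<^sub>v vec ?n (\<lambda>i. f (vs ! i))) $ i = k * f (vs ! i))"
      unfolding eigenvector_def by (auto simp: vec_eq_iff dim simp del: index_mult_mat_vec)
    also have "\<dots> \<longleftrightarrow> ?P f"
      by (simp add: row all_set_conv_all_nth Bex_def in_set_conv_nth del: index_mult_mat_vec cong: conj_cong) blast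
    finally show ?thesis .
  qed
  show ?thesis
  proof
    assume "eigenvalue ?L k"
    then obtain x where x: "eigenvector ?L x k" by (auto simp: eigenvalue_def)
    let ?f = "\<lambda>v. x $ (THE i. i < ?n \<and> vs ! i = v)"
    have "(THE i'. i' < ?n \<and> vs ! i' = vs ! i) = i" if "i < ?n" for i
      using that assms by (intro the_equality) (auto simp: nth_eq_iff_index_eq)
    then have "vec ?n (\<lambda>i. ?f (vs ! i)) = x"
      using x by (auto simp: eigenvector_def dim)
    with x eq[of ?f] show "\<exists>f. ?P f" by auto
  next
    assume "\<exists>f. ?P f"
    then show "eigenvalue ?L k" unfolding eigenvalue_def using eq by blast
  qed
qed

lemma vertex_enum:
  assumes "finite_simple_graph G"
  shows "distinct (vertex_enum G)" "set (vertex_enum G) = fst G"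
proof -
  have "\<exists>vs. distinct vs \<and> set vs = fst G"
    using assms finite_distinct_list[of "fst G"] by (auto simp: finite_simple_graph_def)
  from someI_ex[OF this] show "distinct (vertex_enum G)" "set (vertex_enum G) = fst G"
    by (simp_all add: vertex_enum_def)
qed

lemma spectrum_laplacian_matrix_enum:
  assumes "finite_simple_graph G" "distinct vs" "set vs = fst G"
  shows "spectrum (laplacian_matrix G vs) = spectrum (laplacian_matrix G (vertex_enum G))"
  using assms vertex_enum[OF assms(1)]
  by (auto simp: spectrum_def eigenvalue_laplacian_matrix_iff)

end

theory Submission
  imports Defs
begin

text \<open>If a positive vector \<open>g\<close> satisfies \<open>Q g \<le> \<mu> g\<close> for the signless Laplacian \<open>Q = D + A\<close> of a
  connected graph, with strict inequality at some vertex, then every Laplacian eigenvalue is less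
  than \<open>\<mu>\<close>. On a linear tree such a \<open>g\<close> is obtained from the numbers \<open>S\<^sub>j\<close> and \<open>b\<^sub>i\<close>, all of which are
  negative: their negatives are the quotients of the values of \<open>g\<close> at the next vertex towards \<open>v\<^sub>k\<close>
  and at the vertex itself, so that \<open>Q g = \<mu> g\<close> except at \<open>v\<^sub>k\<close>, where \<open>\<mu> g - Q g = (1 - S\<^sub>k) g > 0\<close>.
  For the monotonicity, \<open>g\<close> is the restriction of the Perron vector of \<open>Q(G\<^sub>k\<^sub>+\<^sub>1)\<close>, whose eigenvalue
  is \<open>\<rho>\<^sub>L(G\<^sub>k\<^sub>+\<^sub>1)\<close> because the tree is bipartite.\<close>

section \<open>Neighbourhoods and the signless Laplacian\<close>

definition neighbours :: "'a graph \<Rightarrow> 'a \<Rightarrow> 'a set" where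
  "neighbours G v = {w \<in> fst G. {v, w} \<in> snd G}"

text \<open>The operator \<open>D + A\<close> written edge by edge: the terms \<open>f v\<close> add
  up to the degree part. For positive \<open>f\<close>, deleting an edge deletes a positive
  term.\<close>

definition signless :: "'a graph \<Rightarrow> ('a \<Rightarrow> real) \<Rightarrow> 'a \<Rightarrow> real" where
  "signless G f v = (\<Sum>w\<in>neighbours G v. f v + f w)"

text \<open>Reachability is phrased with a reflexive transitive closure so that a property passed on
  to neighbours spreads over the graph by \<open>rtrancl_induct\<close>.\<close>

definition connected_graph :: "'a graph \<Rightarrow> bool" where
  "connected_graph G \<longleftrightarrow>
     (\<forall>v\<in>fst G. \<forall>w\<in>fst G. (v, w) \<in> {(a, b). a \<in> fst G \<and> b \<in> neighbours G a}\<^sup>*)"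

definition proper_2_colouring :: "'a graph \<Rightarrow> ('a \<Rightarrow> bool) \<Rightarrow> bool" where
  "proper_2_colouring G c \<longleftrightarrow> (\<forall>v\<in>fst G. \<forall>w\<in>neighbours G v. c v \<noteq> c w)"

lemma finite_neighbours: "finite_simple_graph G \<Longrightarrow> finite (neighbours G v)"
  by (simp add: finite_simple_graph_def neighbours_def)

lemma neighbours_in: "w \<in> neighbours G v \<Longrightarrow> w \<in> fst G"
  by (simp add: neighbours_def)

lemma neighbours_sym: "v \<in> fst G \<Longrightarrow> w \<in> fst G \<Longrightarrow> w \<in> neighbours G v \<longleftrightarrow> v \<in> neighbours G w"
  by (simp add: neighbours_def insert_commute)

lemma vertex_degree_eq_card_neighbours:
  assumes G: "finite_simple_graph G" and v: "v \<in> fst G"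
  shows "vertex_degree G v = card (neighbours G v)"
proof -
  have "bij_betw (\<lambda>w. {v, w}) (neighbours G v) {e \<in> snd G. v \<in> e}"
    unfolding bij_betw_def
  proof
    show "inj_on (\<lambda>w. {v, w}) (neighbours G v)"
      by (auto simp: inj_on_def doubleton_eq_iff)
    show "(\<lambda>w. {v, w}) ` neighbours G v = {e \<in> snd G. v \<in> e}"
    proof (intro equalityI subsetI)
      fix e assume e: "e \<in> {e \<in> snd G. v \<in> e}"
      then have "card e = 2" "e \<subseteq> fst G" "v \<in> e"
        using G by (auto simp: finite_simple_graph_def)
      then obtain w where "e = {v, w}"
        by (auto simp: card_2_iff)
      then show "e \<in> (\<lambda>w. {v, w}) ` neighbours G v"
        using e \<open>e \<subseteq> fst G\<close> by (auto simp: neighbours_def)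
    qed (auto simp: neighbours_def)
  qed
  from bij_betw_same_card[OF this] show ?thesis
    by (simp add: vertex_degree_def)
qed

lemma eigenvalue_laplacian_iff_neighbours:
  assumes G: "finite_simple_graph G"
  shows "eigenvalue (laplacian_matrix G (vertex_enum G)) k \<longleftrightarrow>
    (\<exists>f. (\<exists>v\<in>fst G. f v \<noteq> 0) \<and> (\<forall>v\<in>fst G. (\<Sum>w\<in>neighbours G v. f v - f w) = k * f v))"
proof -
  have fin: "finite (fst G)" using G by (simp add: finite_simple_graph_def)
  have "real (vertex_degree G v) * f v - (\<Sum>w\<in>fst G. if {v, w} \<in> snd G then f w else 0)
      = (\<Sum>w\<in>neighbours G v. f v - f w)" if "v \<in> fst G" for v f
    using vertex_degree_eq_card_neighbours[OF G that] fin
    by (simp add: sum_subtractf neighbours_def sum.inter_filter)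
  then show ?thesis
    using vertex_enum[OF G] by (simp add: eigenvalue_laplacian_matrix_iff cong: conj_cong)
qed

section \<open>Comparison of Laplacian eigenvalues with a positive supersolution\<close>

lemma signless_strict_supersolution_eigenvalue_less:
  fixes g :: "'a \<Rightarrow> real"
  assumes G: "finite_simple_graph G" and conn: "connected_graph G"
    and pos: "\<And>v. v \<in> fst G \<Longrightarrow> 0 < g v"
    and super: "\<And>v. v \<in> fst G \<Longrightarrow> signless G g v \<le> \<mu> * g v"
    and r: "r \<in> fst G" "signless G g r < \<mu> * g r"
    and ev: "eigenvalue (laplacian_matrix G (vertex_enum G)) \<kappa>"
  shows "\<kappa> < \<mu>"
proof (rule ccontr)
  \<comment> \<open>For an eigenvector \<open>f\<close>, the set where \<open>\<bar>f\<bar> / g\<close> is maximal is closed under taking neighbours.\<close>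
  assume "\<not> \<kappa> < \<mu>"
  then have le: "\<mu> \<le> \<kappa>" by simp
  obtain f where f0: "\<exists>v\<in>fst G. f v \<noteq> 0"
    and f: "\<And>v. v \<in> fst G \<Longrightarrow> (\<Sum>w\<in>neighbours G v. f v - f w) = \<kappa> * f v"
    using ev by (auto simp: eigenvalue_laplacian_iff_neighbours[OF G])
  have fin: "finite (fst G)" using G by (simp add: finite_simple_graph_def)
  define M where "M = Max ((\<lambda>v. \<bar>f v\<bar> / g v) ` fst G)"
  have bound: "\<bar>f v\<bar> \<le> M * g v" if v: "v \<in> fst G" for v
  proof -
    have "\<bar>f v\<bar> / g v \<le> M" unfolding M_def using fin v by (intro Max_ge) auto
    then show ?thesis using pos[OF v] by (simp add: field_simps)
  qed
  have "M \<in> (\<lambda>v. \<bar>f v\<bar> / g v) ` fst G"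
    unfolding M_def using fin r by (intro Max_in) auto
  then obtain v0 where v0: "v0 \<in> fst G" "\<bar>f v0\<bar> = M * g v0"
    using pos by (force simp: field_simps)
  have M: "0 < M"
  proof -
    obtain v where v: "v \<in> fst G" "f v \<noteq> 0" using f0 by blast
    have "0 < M * g v" using bound[OF v(1)] v(2) by linarith
    then show ?thesis using pos[OF v(1)] by (simp add: zero_less_mult_iff)
  qed
  have eq_step: "signless G g v = \<mu> * g v \<and> (\<forall>w\<in>neighbours G v. \<bar>f w\<bar> = M * g w)"
    if v: "v \<in> fst G" and eq: "\<bar>f v\<bar> = M * g v" for v
  proof -
    \<comment> \<open>The eigenvalue equation at \<open>v\<close> is multiplied by the sign of
      \<open>f v\<close>; the triangle inequality then turns \<open>D - A\<close> into
      \<open>D + A\<close>.\<close>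
    have le1: "\<kappa> * \<bar>f v\<bar> \<le> (\<Sum>w\<in>neighbours G v. \<bar>f v\<bar> + \<bar>f w\<bar>)"
    proof -
      have sgn: "sgn (f v) * f v = \<bar>f v\<bar>" by (simp add: sgn_if)
      then have "\<kappa> * \<bar>f v\<bar> = sgn (f v) * (\<Sum>w\<in>neighbours G v. f v - f w)"
        using f[OF v] by (metis mult.left_commute)
      also have "\<dots> = (\<Sum>w\<in>neighbours G v. \<bar>f v\<bar> - sgn (f v) * f w)"
        by (simp add: sum_distrib_left right_diff_distrib sgn del: sum_subtractf)
      also have "\<dots> \<le> (\<Sum>w\<in>neighbours G v. \<bar>f v\<bar> + \<bar>f w\<bar>)"
        by (intro sum_mono) (auto simp: sgn_if)
      finally show ?thesis .
    qed
    have le2: "\<bar>f v\<bar> + \<bar>f w\<bar> \<le> M * (g v + g w)" if "w \<in> neighbours G v" for w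
      using bound[OF neighbours_in[OF that]] eq by (simp add: algebra_simps)
    have le3: "(\<Sum>w\<in>neighbours G v. \<bar>f v\<bar> + \<bar>f w\<bar>) \<le> (\<Sum>w\<in>neighbours G v. M * (g v + g w))"
      using le2 by (rule sum_mono)
    have s: "(\<Sum>w\<in>neighbours G v. M * (g v + g w)) = M * signless G g v"
      unfolding signless_def sum_distrib_left ..
    have le4: "M * signless G g v \<le> M * (\<mu> * g v)"
      using super[OF v] M by simp
    have le5: "M * (\<mu> * g v) \<le> \<kappa> * \<bar>f v\<bar>"
      using le M pos[OF v] by (simp add: eq)
    \<comment> \<open>Since \<open>\<mu> \<le> \<kappa>\<close>, the chain \<open>le1\<close>,
      \<open>le3\<close>, \<open>s\<close>, \<open>le4\<close>, \<open>le5\<close> returns to its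
      starting value, so every inequality in it is an equality, and \<open>le3\<close> is one term
      by term.\<close>
    have "(\<Sum>w\<in>neighbours G v. \<bar>f v\<bar> + \<bar>f w\<bar>) = (\<Sum>w\<in>neighbours G v. M * (g v + g w))"
      using le1 le3 s le4 le5 by linarith
    then have "\<bar>f v\<bar> + \<bar>f w\<bar> = M * (g v + g w)" if "w \<in> neighbours G v" for w
      by (rule sum_mono_inv[OF _ le2 that finite_neighbours[OF G]])
    moreover have "M * signless G g v = M * (\<mu> * g v)"
      using le1 le3 s le4 le5 by linarith
    ultimately show ?thesis using M eq by (simp add: algebra_simps)
  qed
  have "(v0, r) \<in> {(a, b). a \<in> fst G \<and> b \<in> neighbours G a}\<^sup>*"
    using conn v0 r by (simp add: connected_graph_def)
  then have "r \<in> fst G \<and> \<bar>f r\<bar> = M * g r"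
  proof (induction rule: rtrancl_induct)
    case (step y z)
    then have "y \<in> fst G" "z \<in> neighbours G y" "\<bar>f y\<bar> = M * g y" by auto
    then show ?case using eq_step neighbours_in[of z G y] by blast
  qed (use v0 in simp)
  then show False using eq_step[of r] r by simp
qed

section \<open>A nonnegative eigenvector of a nonnegative symmetric matrix\<close>

text \<open>For small \<open>t\<close> of the same sign as \<open>a\<close> the linear term would
  win; \<open>t = a / d\<close> with \<open>d > c\<close> is small enough. This extracts the
  first-order condition at a maximum.\<close>

lemma linear_le_quadratic_imp_zero:
  fixes a c :: real
  assumes "\<And>t. t * a \<le> t\<^sup>2 * c"
  shows "a = 0"
proof (rule ccontr)
  assume a: "a \<noteq> 0"
  define d where "d = \<bar>c\<bar> + 1"
  have d: "0 < d" "c < d" by (auto simp: d_def)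
  have "(a / d) * a \<le> (a / d)\<^sup>2 * c" by (rule assms)
  then have "a\<^sup>2 * d \<le> a\<^sup>2 * c" using d by (simp add: power2_eq_square field_simps)
  then show False using a d by (simp add: mult_le_cancel_left)
qed

lemma symmetric_nonneg_eigenvector:
  fixes A :: "'a \<Rightarrow> 'a \<Rightarrow> real"
  assumes fin: "finite V" and ne: "V \<noteq> {}"
    and sym: "\<And>v w. v \<in> V \<Longrightarrow> w \<in> V \<Longrightarrow> A v w = A w v"
    and nonneg: "\<And>v w. v \<in> V \<Longrightarrow> w \<in> V \<Longrightarrow> 0 \<le> A v w"
  obtains g l where "\<And>v. 0 \<le> g v" "\<exists>v\<in>V. g v \<noteq> 0" "\<And>v. v \<in> V \<Longrightarrow> (\<Sum>w\<in>V. A v w * g w) = l * g v"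
proof -
  \<comment> \<open>\<open>g\<close> maximises the quadratic form \<open>q\<close> on the nonnegative part of the unit sphere, and hence on the
    whole sphere, so the first-order condition holds for variations of either sign.\<close>
  define q where "q f = (\<Sum>v\<in>V. \<Sum>w\<in>V. A v w * f v * f w)" for f :: "'a \<Rightarrow> real"
  define n where "n f = (\<Sum>v\<in>V. (f v)\<^sup>2)" for f :: "'a \<Rightarrow> real"
  \<comment> \<open>Functions are fixed to be 0 outside \<open>V\<close>, so \<open>B\<close> is a
    product of compact sets, hence compact by Tychonoff even if the type is infinite.\<close>
  define B where "B = (\<Pi>\<^sub>E v\<in>UNIV. (if v \<in> V then {0..1} else {0::real}))"
  define K where "K = B \<inter> n -` {1}"
  have cont: "continuous_on S (\<lambda>f. f v)" for S and v :: 'a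
    by (rule continuous_on_subset[OF continuous_on_product_coordinates]) simp
  have "compact B"
  proof -
    have "compactin (product_topology (\<lambda>i. euclidean) UNIV) B"
      unfolding B_def by (subst compactin_PiE) auto
    then show ?thesis by (simp add: euclidean_product_topology)
  qed
  moreover have "closed (n -` {1})"
    unfolding n_def by (intro closed_vimage continuous_intros cont)
  ultimately have "compact K" unfolding K_def by (rule compact_Int_closed)
  moreover have "K \<noteq> {}"
  proof -
    obtain u where u: "u \<in> V" using ne by blast
    have "(\<lambda>v. if v = u then 1 else 0) \<in> K"
      using u fin by (auto simp: K_def B_def n_def if_distrib[of "\<lambda>x. x\<^sup>2"] cong: if_cong)
    then show ?thesis by blast
  qed
  moreover have "continuous_on K q"
    unfolding q_def by (intro continuous_intros cont)
  ultimately obtain g where g: "g \<in> K" and gmax: "\<And>f. f \<in> K \<Longrightarrow> q f \<le> q g"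
    using continuous_attains_sup by metis
  define l where "l = q g"
  have g0: "0 \<le> g v" for v
    using g by (cases "v \<in> V") (auto simp: K_def B_def PiE_iff dest: spec[of _ v])
  have ng: "n g = 1" using g by (simp add: K_def)
  have q_scale: "q (\<lambda>v. c * f v) = c\<^sup>2 * q f" for c f
    by (simp add: q_def sum_distrib_left power2_eq_square algebra_simps)
  have n_scale: "n (\<lambda>v. c * f v) = c\<^sup>2 * n f" for c f
    by (simp add: n_def sum_distrib_left power_mult_distrib)
  \<comment> \<open>Replacing \<open>f\<close> by its absolute value keeps \<open>n\<close> and does
    not lower \<open>q\<close>, the entries of \<open>A\<close> being nonnegative; scaling to norm 1
    then lands in \<open>K\<close>.\<close>
  have q_le: "q f \<le> l * n f" for f
  proof (cases "n f = 0")
    case True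
    then have "\<forall>v\<in>V. f v = 0" using fin by (simp add: n_def sum_nonneg_eq_0_iff)
    then show ?thesis using True by (simp add: q_def)
  next
    case False
    then have npos: "0 < n f" using sum_nonneg[of V "\<lambda>v. (f v)\<^sup>2"] by (simp add: n_def)
    define h where "h v = (if v \<in> V then \<bar>f v\<bar> else 0)" for v
    define c where "c = 1 / sqrt (n f)"
    have c: "0 \<le> c" "c\<^sup>2 * n f = 1" using npos by (auto simp: c_def power_divide)
    have nh: "n h = n f" by (simp add: n_def h_def)
    have nch: "n (\<lambda>v. c * h v) = 1" by (simp add: n_scale nh c)
    have "c * h v \<le> 1" if v: "v \<in> V" for v
    proof -
      have "(c * h v)\<^sup>2 \<le> n (\<lambda>v. c * h v)"
        unfolding n_def by (rule member_le_sum) (use v fin in auto)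
      then show ?thesis using nch by (simp add: abs_square_le_1)
    qed
    then have "(\<lambda>v. c * h v) \<in> K"
      using nch c(1) by (auto simp: K_def B_def PiE_iff h_def)
    then have "c\<^sup>2 * q h \<le> l" unfolding l_def q_scale[symmetric] by (rule gmax)
    then have "c\<^sup>2 * n f * q h \<le> l * n f"
      using mult_right_mono[of "c\<^sup>2 * q h" l "n f"] npos by (simp add: mult_ac)
    then have "q h \<le> l * n f" by (simp add: c)
    moreover have "q f \<le> q h" unfolding q_def
    proof (intro sum_mono)
      fix v w assume vw: "v \<in> V" "w \<in> V"
      have "A v w * (f v * f w) \<le> A v w * (\<bar>f v\<bar> * \<bar>f w\<bar>)"
        using nonneg[OF vw] by (intro mult_left_mono) (simp_all flip: abs_mult)
      then show "A v w * f v * f w \<le> A v w * h v * h w" using vw by (simp add: h_def mult.assoc)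
    qed
    ultimately show ?thesis by simp
  qed
  have "(\<Sum>w\<in>V. A v w * g w) = l * g v" if v: "v \<in> V" for v
  proof -
    define e where "e w = (if w = v then 1 else 0 :: real)" for w
    have e_right: "(\<Sum>w\<in>V. X w * e w) = X v" for X :: "'a \<Rightarrow> real"
      using v fin by (simp add: e_def if_distrib cong: if_cong)
    have e_left: "(\<Sum>w\<in>V. e w * X w) = X v" for X :: "'a \<Rightarrow> real"
      using e_right[of X] by (simp only: mult.commute)
    \<comment> \<open>This is \<open>q_le\<close> at \<open>g + t * e\<close> with \<open>e\<close>
      the unit vector at \<open>v\<close>. The constant terms on both sides equal \<open>l\<close>
      and cancel; symmetry of \<open>A\<close> makes the two cross terms equal.\<close>
    have key: "2 * t * (\<Sum>w\<in>V. A v w * g w) + t\<^sup>2 * A v v \<le> l * (2 * t * g v + t\<^sup>2)" for t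
    proof -
      have "q (\<lambda>w. g w + t * e w) = (\<Sum>u\<in>V. \<Sum>w\<in>V. A u w * g u * g w + t * (A u w * g u * e w)
          + t * (e u * (A u w * g w)) + t\<^sup>2 * (e u * A u w * e w))"
        unfolding q_def by (intro sum.cong refl) (simp add: algebra_simps power2_eq_square)
      also have "\<dots> = q g + t * (\<Sum>u\<in>V. \<Sum>w\<in>V. A u w * g u * e w)
          + t * (\<Sum>u\<in>V. \<Sum>w\<in>V. e u * (A u w * g w)) + t\<^sup>2 * (\<Sum>u\<in>V. \<Sum>w\<in>V. e u * A u w * e w)"
        by (simp only: q_def sum.distrib sum_distrib_left)
      also have "(\<Sum>u\<in>V. \<Sum>w\<in>V. A u w * g u * e w) = (\<Sum>w\<in>V. A v w * g w)"
        unfolding e_right using v by (intro sum.cong) (simp_all add: sym)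
      also have "(\<Sum>u\<in>V. \<Sum>w\<in>V. e u * (A u w * g w)) = (\<Sum>w\<in>V. A v w * g w)"
        by (simp only: e_left flip: sum_distrib_left)
      also have "(\<Sum>u\<in>V. \<Sum>w\<in>V. e u * A u w * e w) = A v v"
        by (simp only: e_right e_left)
      finally have 1: "q (\<lambda>w. g w + t * e w) = l + 2 * t * (\<Sum>w\<in>V. A v w * g w) + t\<^sup>2 * A v v"
        by (simp add: l_def)
      have "n (\<lambda>w. g w + t * e w) = (\<Sum>w\<in>V. (g w)\<^sup>2 + 2 * t * (g w * e w) + t\<^sup>2 * (e w * e w))"
        unfolding n_def by (intro sum.cong refl) (simp add: algebra_simps power2_eq_square)
      also have "\<dots> = n g + 2 * t * (\<Sum>w\<in>V. g w * e w) + t\<^sup>2 * (\<Sum>w\<in>V. e w * e w)"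
        by (simp only: n_def sum.distrib sum_distrib_left)
      also have "\<dots> = 1 + 2 * t * g v + t\<^sup>2"
        unfolding e_right ng by (simp add: e_def)
      finally have "n (\<lambda>w. g w + t * e w) = 1 + 2 * t * g v + t\<^sup>2" .
      then show ?thesis using q_le[of "\<lambda>w. g w + t * e w"] 1 by (simp add: distrib_left)
    qed
    have "t * (2 * ((\<Sum>w\<in>V. A v w * g w) - l * g v)) \<le> t\<^sup>2 * (l - A v v)" for t
      using key[of t] by (simp add: algebra_simps)
    from linear_le_quadratic_imp_zero[OF this] show ?thesis by simp
  qed
  moreover have "\<exists>v\<in>V. g v \<noteq> 0"
  proof (rule ccontr)
    assume "\<not> (\<exists>v\<in>V. g v \<noteq> 0)"
    then have "n g = 0" by (simp add: n_def)
    with ng show False by simp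
  qed
  ultimately show ?thesis using that g0 by blast
qed

section \<open>The Laplacian spectral radius of connected bipartite graphs\<close>

text \<open>The spectrum is finite, and \<open>l\<close> witnesses that it is nonempty, so the
  \<open>Max\<close> defining \<open>rho_L\<close> is attained.\<close>

lemma rho_L_greatest_eigenvalue:
  assumes "eigenvalue (laplacian_matrix G (vertex_enum G)) l"
  shows "eigenvalue (laplacian_matrix G (vertex_enum G)) (rho_L G)" and "l \<le> rho_L G"
proof -
  let ?L = "laplacian_matrix G (vertex_enum G)"
  have "?L \<in> carrier_mat (length (vertex_enum G)) (length (vertex_enum G))"
    by (auto simp: laplacian_matrix_def degree_matrix_def adjacency_matrix_def)
  then have fin: "finite (spectrum ?L)"
    using card_finite_spectrum(1) by blast
  have "rho_L G \<in> spectrum ?L"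
    unfolding rho_L_def using assms fin by (intro Max_in) (auto simp: spectrum_def)
  then show "eigenvalue ?L (rho_L G)" by (simp add: spectrum_def)
  show "l \<le> rho_L G"
    unfolding rho_L_def using assms fin by (intro Max_ge) (auto simp: spectrum_def)
qed

text \<open>Changing the sign of a \<open>D + A\<close> eigenvector on one colour class gives a
  \<open>D - A\<close> eigenvector for the same eigenvalue. The last conclusion records that
  \<open>rho_L G\<close> is attained, as the comparison lemma requires of the number it
  bounds.\<close>

lemma rho_L_signless_eigenvector:
  assumes G: "finite_simple_graph G" and conn: "connected_graph G"
    and ne: "fst G \<noteq> {}" and col: "proper_2_colouring G c"
  obtains g where "\<And>v. v \<in> fst G \<Longrightarrow> 0 < g v"
    and "\<And>v. v \<in> fst G \<Longrightarrow> signless G g v = rho_L G * g v"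
    and "eigenvalue (laplacian_matrix G (vertex_enum G)) (rho_L G)"
proof -
  let ?V = "fst G" and ?L = "laplacian_matrix G (vertex_enum G)"
  have fin: "finite ?V" using G by (simp add: finite_simple_graph_def)
  define A where "A v w = (if v = w then real (card (neighbours G v)) else 0)
     + (if w \<in> neighbours G v then 1 else 0)" for v w
  have symA: "A v w = A w v" if "v \<in> ?V" "w \<in> ?V" for v w
    using neighbours_sym[OF that] by (auto simp: A_def)
  have A_row: "(\<Sum>w\<in>?V. A v w * f w) = signless G f v" if v: "v \<in> ?V" for f v
  proof -
    have "(\<Sum>w\<in>?V. A v w * f w) = (\<Sum>w\<in>?V. if v = w then real (card (neighbours G v)) * f w else 0)
       + (\<Sum>w\<in>?V. if w \<in> neighbours G v then f w else 0)"
      by (simp add: A_def distrib_right sum.distrib if_distrib[of "\<lambda>x. x * _"] cong: if_cong)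
    also have "\<dots> = signless G f v"
      using v fin by (simp add: signless_def sum.distrib neighbours_def sum.inter_filter)
    finally show ?thesis .
  qed
  obtain g l where g0: "\<And>v. 0 \<le> g v" and gne: "\<exists>v\<in>?V. g v \<noteq> 0"
    and gA: "\<And>v. v \<in> ?V \<Longrightarrow> (\<Sum>w\<in>?V. A v w * g w) = l * g v"
    using symmetric_nonneg_eigenvector[OF fin ne, of A] symA by (auto simp: A_def)
  have gl: "signless G g v = l * g v" if "v \<in> ?V" for v
    using gA[OF that] A_row[OF that] by simp
  have pos: "0 < g v" if v: "v \<in> ?V" for v
  proof (rule ccontr)
    assume "\<not> 0 < g v"
    then have gv: "g v = 0" using g0[of v] by linarith
    obtain u where u: "u \<in> ?V" "g u \<noteq> 0" using gne by blast
    have "(v, u) \<in> {(a, b). a \<in> fst G \<and> b \<in> neighbours G a}\<^sup>*"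
      using conn v u by (simp add: connected_graph_def)
    \<comment> \<open>Where \<open>g\<close> vanishes, the eigenvalue equation makes the nonnegative
      values at the neighbours sum to 0, so zeros spread along paths.\<close>
    then have "g u = 0"
    proof (induction rule: rtrancl_induct)
      case (step y z)
      then have y: "y \<in> ?V" "z \<in> neighbours G y" "g y = 0" by auto
      then have "(\<Sum>w\<in>neighbours G y. g w) = 0" using gl[of y] by (simp add: signless_def)
      then show ?case
        using y g0 finite_neighbours[OF G] by (simp add: sum_nonneg_eq_0_iff)
    qed (fact gv)
    then show False using u by simp
  qed
  have ev: "eigenvalue ?L l"
    unfolding eigenvalue_laplacian_iff_neighbours[OF G]
  proof (intro exI conjI ballI)
    let ?f = "\<lambda>v. if c v then g v else - g v"
    show "\<exists>v\<in>?V. ?f v \<noteq> 0" using gne by auto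
    fix v assume v: "v \<in> ?V"
    have "(\<Sum>w\<in>neighbours G v. ?f v - ?f w) = (\<Sum>w\<in>neighbours G v. (if c v then 1 else -1) * (g v + g w))"
      using col v by (intro sum.cong) (auto simp: proper_2_colouring_def)
    also have "\<dots> = (if c v then 1 else -1) * signless G g v"
      unfolding signless_def sum_distrib_left ..
    finally show "(\<Sum>w\<in>neighbours G v. ?f v - ?f w) = l * ?f v" using gl[OF v] by auto
  qed
  note ev_rho = rho_L_greatest_eigenvalue[OF ev]
  \<comment> \<open>If \<open>rho_L G\<close> exceeded \<open>l\<close>, then \<open>g\<close> would
    be a strict supersolution for \<open>rho_L G\<close>, and the comparison would put
    \<open>rho_L G\<close> below itself.\<close>
  have "rho_L G \<le> l"
  proof (rule ccontr)
    assume "\<not> rho_L G \<le> l"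
    then have lt: "signless G g v < rho_L G * g v" if "v \<in> ?V" for v
      using gl[OF that] pos[OF that] by simp
    then have le: "signless G g v \<le> rho_L G * g v" if "v \<in> ?V" for v
      using that by (simp add: less_imp_le)
    obtain r where r: "r \<in> ?V" using ne by blast
    have "rho_L G < rho_L G"
      by (rule signless_strict_supersolution_eigenvalue_less[OF G conn pos le r lt[OF r] ev_rho(1)])
    then show False by simp
  qed
  with ev_rho(2) have "rho_L G = l" by simp
  then show ?thesis using that[of g] pos gl ev_rho(1) by simp
qed

text \<open>With \<open>g\<close> the Perron vector of \<open>H\<close>, passing to \<open>G\<close>
  drops terms \<open>g v + g w > 0\<close> from the sums, at least one of them at \<open>r\<close>.
  So \<open>g\<close> is a strict supersolution on \<open>G\<close> for
  \<open>rho_L H\<close>.\<close>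

lemma rho_L_less_supergraph:
  assumes G: "finite_simple_graph G" "connected_graph G" "proper_2_colouring G c"
    and H: "finite_simple_graph H" "connected_graph H" "proper_2_colouring H c'"
    and sub: "fst G \<subseteq> fst H" "snd G \<subseteq> snd H"
    and r: "r \<in> fst G" "neighbours G r \<noteq> neighbours H r"
  shows "rho_L G < rho_L H"
proof -
  have "fst G \<noteq> {}" "fst H \<noteq> {}" using r sub by auto
  obtain g where pos: "\<And>v. v \<in> fst H \<Longrightarrow> 0 < g v"
    and g: "\<And>v. v \<in> fst H \<Longrightarrow> signless H g v = rho_L H * g v"
    using rho_L_signless_eigenvector[OF H(1,2) \<open>fst H \<noteq> {}\<close> H(3)] by metis
  have ev: "eigenvalue (laplacian_matrix G (vertex_enum G)) (rho_L G)"
    using rho_L_signless_eigenvector[OF G(1,2) \<open>fst G \<noteq> {}\<close> G(3)] by metis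
  have nsub: "neighbours G v \<subseteq> neighbours H v" for v
    using sub by (auto simp: neighbours_def)
  have p2: "0 < g v + g w" if "v \<in> fst G" "w \<in> neighbours H v" for v w
    using that sub pos[of v] pos[of w] neighbours_in[of w H v] by force
  have le: "signless G g v \<le> rho_L H * g v" if v: "v \<in> fst G" for v
  proof -
    have "signless G g v \<le> signless H g v" unfolding signless_def
      by (intro sum_mono2 finite_neighbours[OF H(1)] nsub) (use p2[OF v] in \<open>auto intro: less_imp_le\<close>)
    then show ?thesis using g[of v] v sub by auto
  qed
  obtain w where w: "w \<in> neighbours H r - neighbours G r" using r nsub by blast
  have "signless G g r < signless H g r" unfolding signless_def
    by (rule sum_strict_mono2[OF finite_neighbours[OF H(1)] nsub w])
      (use p2[OF r(1)] w in \<open>auto intro: less_imp_le\<close>)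
  then have "signless G g r < rho_L H * g r" using g[of r] r sub by auto
  then show ?thesis
    using signless_strict_supersolution_eigenvalue_less[OF G(1,2) _ le r(1) _ ev] pos sub by blast
qed

subsection \<open>Linear trees\<close>

lemma Main_in_linear_tree: "Main j \<in> fst (linear_tree Ts) \<longleftrightarrow> j < length Ts"
  by (simp add: linear_tree_def)

lemma Pend_in_linear_tree:
  "Pend j i m \<in> fst (linear_tree Ts) \<longleftrightarrow> j < length Ts \<and> i < length (Ts ! j) \<and> m < Ts ! j ! i"
  by (simp add: linear_tree_def)

lemma neighbours_Main:
  assumes "j < length Ts"
  shows "neighbours (linear_tree Ts) (Main j) =
    (if 0 < j then {Main (j - 1)} else {}) \<union> (if Suc j < length Ts then {Main (Suc j)} else {}) \<union>
    (\<lambda>i. Pend j i 0) ` {i. i < length (Ts ! j) \<and> 0 < Ts ! j ! i}"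
  using assms unfolding neighbours_def linear_tree_def
  by (auto simp: doubleton_eq_iff gr0_conv_Suc)

lemma neighbours_Pend:
  assumes "j < length Ts" "i < length (Ts ! j)" "m < Ts ! j ! i"
  shows "neighbours (linear_tree Ts) (Pend j i m) =
    {if m = 0 then Main j else Pend j i (m - 1)} \<union> (if Suc m < Ts ! j ! i then {Pend j i (Suc m)} else {})"
  using assms unfolding neighbours_def linear_tree_def
  by (cases m) (auto simp: doubleton_eq_iff)

text \<open>Every vertex has a path to \<open>Main 0\<close>, and adjacency is symmetric.\<close>

lemma connected_linear_tree: "connected_graph (linear_tree Ts)"
proof -
  let ?G = "linear_tree Ts"
  let ?E = "{(a, b). a \<in> fst ?G \<and> b \<in> neighbours ?G a}"
  have "sym ?E" by (auto simp: sym_def neighbours_def insert_commute)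
  then have symE: "sym (?E\<^sup>*)" by (rule sym_rtrancl)
  have main: "(Main j, Main 0) \<in> ?E\<^sup>*" if "j < length Ts" for j
    using that
  proof (induction j)
    case (Suc j)
    then have "(Main (Suc j), Main j) \<in> ?E"
      by (auto simp: Main_in_linear_tree neighbours_Main)
    with Suc show ?case by (meson Suc_lessD converse_rtrancl_into_rtrancl)
  qed simp
  have pend: "(Pend j i m, Main 0) \<in> ?E\<^sup>*" if "j < length Ts" "i < length (Ts ! j)" "m < Ts ! j ! i" for j i m
    using that
  proof (induction m)
    case 0
    then have "(Pend j i 0, Main j) \<in> ?E"
      by (auto simp: Pend_in_linear_tree neighbours_Pend)
    with main[OF 0(1)] show ?case by (meson converse_rtrancl_into_rtrancl)
  next
    case (Suc m)
    then have "(Pend j i (Suc m), Pend j i m) \<in> ?E"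
      by (auto simp: Pend_in_linear_tree neighbours_Pend)
    with Suc show ?case by (meson Suc_lessD converse_rtrancl_into_rtrancl)
  qed
  have "(v, Main 0) \<in> ?E\<^sup>*" if "v \<in> fst ?G" for v
    using that main pend by (cases v) (auto simp: Main_in_linear_tree Pend_in_linear_tree)
  then show ?thesis
    unfolding connected_graph_def using symE by (meson rtrancl_trans symD)
qed

text \<open>The colour is the parity of the distance to \<open>Main 0\<close>;
  \<open>Pend j i m\<close> is \<open>m + 1\<close> steps away from \<open>Main j\<close>.\<close>

lemma proper_2_colouring_linear_tree:
  "proper_2_colouring (linear_tree Ts) (\<lambda>v. case v of Main j \<Rightarrow> even j | Pend j i m \<Rightarrow> even (j + Suc m))"
  unfolding proper_2_colouring_def
proof (intro ballI)
  fix v w assume v: "v \<in> fst (linear_tree Ts)" and w: "w \<in> neighbours (linear_tree Ts) v"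
  show "(case v of Main j \<Rightarrow> even j | Pend j i m \<Rightarrow> even (j + Suc m)) \<noteq>
      (case w of Main j \<Rightarrow> even j | Pend j i m \<Rightarrow> even (j + Suc m))"
    using v w
    by (cases v) (auto simp: Main_in_linear_tree Pend_in_linear_tree neighbours_Main neighbours_Pend
        split: if_splits)
qed

text \<open>The last main vertex of the shorter tree gains \<open>Main (length Ts)\<close> as a
  neighbour, whatever starlike tree is attached there.\<close>

lemma rho_L_linear_tree_append_less:
  assumes "Ts \<noteq> []"
  shows "rho_L (linear_tree Ts) < rho_L (linear_tree (Ts @ [T]))"
proof -
  let ?r = "Main (length Ts - 1)"
  show ?thesis
  proof (rule rho_L_less_supergraph[where r = ?r])
    show "fst (linear_tree Ts) \<subseteq> fst (linear_tree (Ts @ [T]))"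
      unfolding linear_tree_def by (auto simp: nth_append)
    show "snd (linear_tree Ts) \<subseteq> snd (linear_tree (Ts @ [T]))"
      unfolding linear_tree_def by (auto simp: nth_append; force simp: nth_append)
    show "?r \<in> fst (linear_tree Ts)" using assms by (simp add: Main_in_linear_tree)
    have "Main (length Ts) \<in> neighbours (linear_tree (Ts @ [T])) ?r"
      using assms by (simp add: neighbours_Main)
    moreover have "Main (length Ts) \<notin> neighbours (linear_tree Ts) ?r"
      by (simp add: neighbours_def Main_in_linear_tree)
    ultimately show "neighbours (linear_tree Ts) ?r \<noteq> neighbours (linear_tree (Ts @ [T])) ?r"
      by blast
  qed (rule finite_simple_graph_linear_tree connected_linear_tree proper_2_colouring_linear_tree)+
qed

subsection \<open>The supersolution\<close>

text \<open>For \<open>\<omega> > 0\<close> one has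
  \<open>\<omega> + inverse \<omega> \<ge> 2\<close>. Positivity of \<open>\<omega>\<close> follows
  from \<open>19 - 3 * 6 > 0\<close>. Above 4 the radicand in \<open>\<theta>\<close> is
  positive.\<close>

lemma \<mu>_min_ge_4: "4 \<le> \<mu>_min"
proof -
  have "sqrt 33 < 6" by (rule real_less_lsqrt) auto
  then have "0 < root 3 (19 + 3 * sqrt 33)" "0 < root 3 (19 - 3 * sqrt 33)"
    by (simp_all add: add_pos_nonneg)
  then have w: "0 < \<omega>"
    unfolding \<omega>_def by (intro divide_pos_pos add_pos_pos) simp_all
  have "0 \<le> (\<omega> - 1)\<^sup>2 / \<omega>" using w by simp
  also have "\<dots> = \<omega> + inverse \<omega> - 2" using w by (simp add: field_simps power2_eq_square)
  finally show ?thesis by (simp add: \<mu>_min_def)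
qed

text \<open>\<open>\<theta> \<mu>\<close> is the smaller root of t^2 + (\<mu> - 2) t + 1 = 0, the
  fixed point equation of \<open>\<psi> \<mu>\<close>.\<close>

lemma \<theta>_fixed_point:
  assumes "4 < \<mu>"
  shows "\<theta> \<mu> < 0" "1 - \<mu> < \<theta> \<mu>" "2 - \<mu> - 1 / \<theta> \<mu> = \<theta> \<mu>"
proof -
  define s where "s = sqrt ((\<mu> - 2)\<^sup>2 - 4)"
  have "2\<^sup>2 < (\<mu> - 2)\<^sup>2" using assms by (intro power_strict_mono) auto
  then have s: "s\<^sup>2 = (\<mu> - 2)\<^sup>2 - 4" "0 \<le> s" by (auto simp: s_def)
  have \<theta>: "\<theta> \<mu> = (2 - \<mu> - s) / 2" by (simp add: \<theta>_def s_def)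
  show neg: "\<theta> \<mu> < 0" using assms s by (simp add: \<theta>)
  have "s\<^sup>2 < \<mu>\<^sup>2" using assms s by (simp add: power2_eq_square algebra_simps)
  then have "s < \<mu>" by (rule power2_less_imp_less) (use assms in simp)
  then show "1 - \<mu> < \<theta> \<mu>" by (simp add: \<theta>)
  have "\<theta> \<mu> * \<theta> \<mu> = (2 - \<mu>) * \<theta> \<mu> - 1"
    using s(1) by (simp add: \<theta> power2_eq_square field_simps)
  then show "2 - \<mu> - 1 / \<theta> \<mu> = \<theta> \<mu>" using neg by (simp add: field_simps)
qed

text \<open>The map \<open>\<psi> \<mu>\<close> is increasing on the negative reals and fixes
  \<open>\<theta> \<mu>\<close>, so it preserves being below \<open>\<theta> \<mu>\<close>; the
  start \<open>1 - \<mu>\<close> is below.\<close>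

lemma b_seq_less_\<theta>:
  assumes "4 < \<mu>" "0 < q"
  shows "b_seq \<mu> q < \<theta> \<mu>"
proof -
  have "b_seq \<mu> (Suc i) < \<theta> \<mu>" for i
  proof (induction i)
    case (Suc i)
    have "1 / \<theta> \<mu> < 1 / b_seq \<mu> (Suc i)"
      using Suc \<theta>_fixed_point(1)[OF assms(1)]
      by (intro divide_strict_left_mono) (auto intro: mult_neg_neg)
    then show ?case using \<theta>_fixed_point(3)[OF assms(1)] by simp
  qed (use \<theta>_fixed_point(2)[OF assms(1)] in simp)
  then show ?thesis using assms(2) by (cases q) auto
qed

text \<open>The index set is that of the pendant neighbours in \<open>neighbours_Main\<close>. For
  \<open>[0]\<close> it is empty, so the dummy \<open>b_seq \<mu> 0\<close> never enters.\<close>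

lemma drift_eq_sum:
  assumes "starlike_tree T"
  shows "drift T \<mu> = (\<Sum>i | i < length T \<and> 0 < T ! i. 1 - 1 / b_seq \<mu> (T ! i))"
proof (cases "T = [0]")
  case True
  then have "{i. i < length T \<and> 0 < T ! i} = {}" by (auto simp: nth_Cons')
  then have "(\<Sum>i | i < length T \<and> 0 < T ! i. 1 - 1 / b_seq \<mu> (T ! i)) = 0"
    by (simp only: sum.empty)
  then show ?thesis using True by (simp only: drift_def if_True refl)
next
  case False
  then have "{i. i < length T \<and> 0 < T ! i} = {..<length T}"
    using assms by (auto simp: starlike_tree_def)
  then show ?thesis
    using False by (simp add: drift_def sum_list_sum_nth atLeast0LessThan)
qed

text \<open>Indices start at 0 here: \<open>S j\<close> belongs to \<open>Main j\<close>. Negativity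
  of all \<open>S j\<close> makes the supersolution positive.\<close>

lemma rho_L_linear_tree_less:
  fixes S :: "nat \<Rightarrow> real"
  assumes \<mu>: "4 < \<mu>" and ne: "Ts \<noteq> []" and star: "\<And>T. T \<in> set Ts \<Longrightarrow> starlike_tree T"
    and S0: "S 0 = 1 - \<mu> + drift (Ts ! 0) \<mu>"
    and SS: "\<And>j. Suc j < length Ts \<Longrightarrow> S (Suc j) = 2 - \<mu> - 1 / S j + drift (Ts ! Suc j) \<mu>"
    and neg: "\<And>j. j < length Ts \<Longrightarrow> S j < 0"
  shows "rho_L (linear_tree Ts) < \<mu>"
proof -
  let ?G = "linear_tree Ts"
  let ?b = "b_seq \<mu>"
  \<comment> \<open>\<open>h\<close> gives the values on the main path, with quotients
    \<open>- S j\<close>. \<open>p q m\<close> is the value at vertex \<open>m\<close> of a pendant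
    path with \<open>q\<close> vertices relative to its main vertex; going outwards the index of
    \<open>b_seq\<close> falls from \<open>q\<close> to 1 at the leaf.\<close>
  define h where "h j = (\<Prod>l<j. - S l)" for j
  define p where "p q m = (\<Prod>s\<le>m. - 1 / ?b (q - s))" for q m
  define g where "g v = (case v of Main j \<Rightarrow> h j | Pend j i m \<Rightarrow> h j * p (Ts ! j ! i) m)" for v
  have g_Main: "g (Main j) = h j" for j
    by (simp add: g_def)
  have h_Suc: "h (Suc j) = - (h j * S j)" for j
    by (simp add: h_def)
  have bneg: "?b q < 0" if "0 < q" for q
    using b_seq_less_\<theta>[OF \<mu> that] \<theta>_fixed_point(1)[OF \<mu>] by linarith
  have hpos: "0 < h j" if "j \<le> length Ts" for j
    unfolding h_def using that neg by (intro prod_pos) auto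
  have ppos: "0 < p q m" if "m < q" for q m
    unfolding p_def using that bneg by (intro prod_pos) (auto simp: divide_neg_neg)
  have pos: "0 < g v" if "v \<in> fst ?G" for v
    using that by (cases v) (auto simp: g_def Main_in_linear_tree Pend_in_linear_tree hpos ppos)
  have pend: "signless ?G g (Pend j i m) = \<mu> * g (Pend j i m)"
    if "j < length Ts" "i < length (Ts ! j)" "m < Ts ! j ! i" for j i m
  proof -
    let ?q = "Ts ! j ! i"
    define prev where "prev = (if m = 0 then Main j else Pend j i (m - 1))"
    have bm: "?b (?q - m) < 0" using that by (intro bneg) simp
    have gprev: "g prev = - ?b (?q - m) * g (Pend j i m)"
      using bm by (cases m) (auto simp: prev_def g_def p_def)
    show ?thesis
    proof (cases "Suc m < ?q")
      case True
      then obtain d where d: "?q - m = Suc (Suc d)" "?q - Suc m = Suc d"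
        by (metis Suc_diff_Suc Suc_lessD zero_less_diff gr0_conv_Suc diff_Suc_Suc)
      have gnext: "g (Pend j i (Suc m)) = - g (Pend j i m) / ?b (Suc d)"
        by (simp add: g_def p_def d)
      have "neighbours ?G (Pend j i m) = {prev, Pend j i (Suc m)}"
        using neighbours_Pend[OF that] True by (auto simp: prev_def)
      moreover have "prev \<noteq> Pend j i (Suc m)" by (auto simp: prev_def)
      ultimately have "signless ?G g (Pend j i m) =
          2 * g (Pend j i m) + g prev + g (Pend j i (Suc m))"
        by (simp add: signless_def)
      \<comment> \<open>By the recursion of \<open>b_seq\<close>, the two terms
        \<open>1 / ?b (Suc d)\<close> cancel. At the leaf below, the same role is played by
        \<open>1 - ?b 1 = \<mu>\<close>.\<close>
      also have "\<dots> = \<mu> * g (Pend j i m)"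
        unfolding gprev gnext d by (simp add: algebra_simps)
      finally show ?thesis .
    next
      case False
      then have "?q - m = Suc 0" using that by simp
      moreover have "neighbours ?G (Pend j i m) = {prev}"
        using neighbours_Pend[OF that] False by (simp add: prev_def)
      ultimately show ?thesis
        using gprev by (simp add: signless_def algebra_simps)
    qed
  qed
  \<comment> \<open>At the last main vertex the edge onwards is missing; it would contribute
    \<open>h j + h (Suc j) = (1 - S j) * h j\<close>.\<close>
  have main: "signless ?G g (Main j) =
      \<mu> * g (Main j) - (if Suc j < length Ts then 0 else (1 - S j) * g (Main j))"
    if j: "j < length Ts" for j
  proof -
    let ?I = "{i. i < length (Ts ! j) \<and> 0 < Ts ! j ! i}"
    have "signless ?G g (Main j) = (if 0 < j then h j + h (j - 1) else 0)
        + (if Suc j < length Ts then h j + h (Suc j) else 0)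
        + (\<Sum>w\<in>(\<lambda>i. Pend j i 0) ` ?I. h j + g w)"
      unfolding signless_def neighbours_Main[OF j]
      by (subst sum.union_disjoint, simp, simp, force, subst sum.union_disjoint)
        (auto simp: g_def)
    \<comment> \<open>A pendant path with \<open>q\<close> vertices contributes
      \<open>h j * (1 + p q 0)\<close>, and \<open>1 + p q 0 = 1 - 1 / ?b q\<close> is its summand
      in the drift.\<close>
    also have "(\<Sum>w\<in>(\<lambda>i. Pend j i 0) ` ?I. h j + g w) = h j * drift (Ts ! j) \<mu>"
      using star[of "Ts ! j"] j
      by (subst sum.reindex)
        (auto simp: inj_on_def drift_eq_sum g_def p_def sum_distrib_left algebra_simps)
    \<comment> \<open>The recursion for \<open>S\<close> solved for the edge backwards: the factor
      is \<open>1 - 1 / S (j - 1)\<close> for positive \<open>j\<close>, and 0 for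
      \<open>j = 0\<close>.\<close>
    also have "(if 0 < j then h j + h (j - 1) else 0) = h j * (S j - 1 + \<mu> - drift (Ts ! j) \<mu>)"
    proof (cases j)
      case (Suc l)
      have "S l < 0" using neg Suc j by simp
      then have "S l * (S j - 1 + \<mu> - drift (Ts ! j) \<mu>) = S l - 1"
        using SS[of l] j Suc by (simp add: right_diff_distrib distrib_left)
      moreover have "h j = - (h l * S l)" by (simp add: h_Suc Suc)
      ultimately have "h j * (S j - 1 + \<mu> - drift (Ts ! j) \<mu>) = - (h l * (S l - 1))"
        by (simp add: mult.assoc)
      then show ?thesis using \<open>h j = - (h l * S l)\<close> Suc by (simp add: algebra_simps)
    qed (simp add: S0)
    finally show ?thesis
      by (cases "Suc j < length Ts") (simp_all add: g_Main h_Suc algebra_simps)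
  qed
  have super: "signless ?G g v \<le> \<mu> * g v" if v: "v \<in> fst ?G" for v
  proof (cases v)
    case (Main j)
    then show ?thesis using main[of j] v neg[of j] pos[OF v] by (auto simp: Main_in_linear_tree)
  next
    case (Pend j i m)
    then show ?thesis using pend v by (simp add: Pend_in_linear_tree)
  qed
  define r where "r = length Ts - 1"
  have r: "r < length Ts" "\<not> Suc r < length Ts" using ne by (auto simp: r_def)
  then have rG: "Main r \<in> fst ?G" by (simp add: Main_in_linear_tree)
  have strict: "signless ?G g (Main r) < \<mu> * g (Main r)"
    using main[OF r(1)] r neg[OF r(1)] pos[OF rG] by simp
  have "fst ?G \<noteq> {}" using rG by auto
  then have ev: "eigenvalue (laplacian_matrix ?G (vertex_enum ?G)) (rho_L ?G)"
    using rho_L_signless_eigenvector[OF finite_simple_graph_linear_tree connected_linear_tree _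
        proper_2_colouring_linear_tree] by metis
  show ?thesis
    by (rule signless_strict_supersolution_eigenvalue_less[OF finite_simple_graph_linear_tree
        connected_linear_tree pos super rG strict ev])
qed

section \<open>Bound, strict growth and convergence along the sequence of trees\<close>

theorem mainTheorem4:
  fixes \<mu> :: real and T :: "nat \<Rightarrow> nat list" and S :: "nat \<Rightarrow> real"
    and G :: "nat \<Rightarrow> lt_vertex graph"
  assumes "\<mu> > \<mu>_min"
    and "\<And>j. 1 \<le> j \<Longrightarrow> starlike_tree (T j)"
    and "S 1 = 1 - \<mu> + drift (T 1) \<mu>"
    and "\<And>j. 2 \<le> j \<Longrightarrow> S j = \<psi> \<mu> (S (j - 1)) + drift (T j) \<mu>"
    and "\<And>j. 1 \<le> j \<Longrightarrow> S j < inverse (\<theta> \<mu>)"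
    and "\<And>k. 1 \<le> k \<Longrightarrow> G k = linear_tree (map T [1..<k + 1])"
  shows "(\<forall>k\<ge>1. rho_L (G k) < \<mu> \<and> rho_L (G k) < rho_L (G (k + 1))) \<and>
    (\<exists>l. (\<lambda>k. rho_L (G k)) \<longlonglongrightarrow> l \<and> l \<le> \<mu>)"
proof -
  have \<mu>: "4 < \<mu>" using assms(1) \<mu>_min_ge_4 by linarith
  have neg: "S j < 0" if "1 \<le> j" for j
    using assms(5)[OF that] \<theta>_fixed_point(1)[OF \<mu>] by (smt (verit) inverse_negative_iff_negative)
  have less: "rho_L (G k) < \<mu>" if k: "1 \<le> k" for k
    unfolding assms(6)[OF k]
  \<comment> \<open>The shift \<open>S (Suc j)\<close> translates the numbering from 1 into the list
    positions from 0.\<close>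
  proof (rule rho_L_linear_tree_less[OF \<mu>, where S = "\<lambda>j. S (Suc j)"])
    show "S (Suc 0) = 1 - \<mu> + drift (map T [1..<k + 1] ! 0) \<mu>"
      using assms(3) k by (simp del: upt_Suc)
    show "S (Suc (Suc j)) = 2 - \<mu> - 1 / S (Suc j) + drift (map T [1..<k + 1] ! Suc j) \<mu>"
      if "Suc j < length (map T [1..<k + 1])" for j
      using assms(4)[of "Suc (Suc j)"] that by (simp add: \<psi>_def del: upt_Suc)
  qed (use k assms(2) neg in \<open>auto simp del: upt_Suc\<close>)
  have mono: "rho_L (G k) < rho_L (G (k + 1))" if k: "1 \<le> k" for k
    using rho_L_linear_tree_append_less[of "map T [1..<k + 1]" "T (k + 1)"] k
    by (simp add: assms(6))
  \<comment> \<open>The sequence is shifted because \<open>G 0\<close> is unspecified; the limit is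
    unaffected.\<close>
  have "incseq (\<lambda>k. rho_L (G (k + 1)))"
    by (rule incseq_SucI) (use mono in \<open>auto intro: less_imp_le\<close>)
  then obtain l where l: "(\<lambda>k. rho_L (G (k + 1))) \<longlonglongrightarrow> l"
    using incseq_convergent[of _ \<mu>] less by (metis le_add2 less_imp_le)
  then have "(\<lambda>k. rho_L (G k)) \<longlonglongrightarrow> l" by (simp add: filterlim_sequentially_Suc[of "\<lambda>k. rho_L (G k)"])
  moreover have "l \<le> \<mu>"
    using less by (intro LIMSEQ_le_const2[OF l]) (auto intro!: exI[of _ 0] less_imp_le)
  ultimately show ?thesis using less mono by blast
qed

end
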